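(* Let $k,d,n$ be integers with $3\le k\le d+1$ and $n\ge 3$. If $k=3$ and $n=4$, then $\omega^3_d(C_4)=4$. Otherwise, \[\omega^k_d(C_n)=\begin{cases} n&\text{if } n\le k-1,\\ k-1&\text{if } n\ge k\text{ and }\lfloor n/2\rfloor+1\le k-1,\\ \min\left(\lfloor n/2\rfloor+1,\,d+1\right)&\text{if }\lfloor n/2\rfloor+1>k-1.\end{cases}\] Equivalently (still excluding the case $k=3$, $n=4$), \[\omega^k_d(C_n)=\begin{cases} n&\text{if } n\le k-1,\\ k-1&\text{if } k\le n\le 2k-3,\\ \lfloor n/2\rfloor+1&\text{if } 2k-2\le n\le 2d-1,\\ d+1&\text{if } n\ge 2d.\end{cases}\]
   Context: $C_n$ is the cycle graph on $n$ vertices. A shortest path in a graph $G$ is a path between some vertices $u,v$ whose length (number of edges) equals the graph distance between $u$ and $v$. A set $S\subseteq V(G)$ is a $k,d$-clique in $G$ if every $k$-element subset of $S$ is contained in some shortest path of $G$ of length at most $d$ (sets with fewer than $k$ elements are vacuously $k,d$-cliques). $\omega^k_d(G)$ is the supremum of the sizes of $k,d$-cliques in $G$. *)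

theory Defs
  imports "Graph_Theory.Graph_Theory" "HOL-Library.Extended_Nat"
begin

text \<open>An undirected simple graph is a symmetric loop-free digraph: every edge
  is present as two opposite arcs.\<close>

definition cycle_graph :: "nat \<Rightarrow> nat pair_pre_digraph" where
  "cycle_graph n = \<lparr> pverts = {..<n},
     parcs = {(i, j). i < n \<and> j < n \<and> (j = (i + 1) mod n \<or> i = (j + 1) mod n)} \<rparr>"

lemma pair_graph_cycle_graph:
  assumes "n \<ge> 3"
  shows "pair_graph (cycle_graph n)"
proof unfold_locales
  have "parcs (cycle_graph n) \<subseteq> {..<n} \<times> {..<n}"
    by (auto simp: cycle_graph_def)
  then show "finite (parcs (cycle_graph n))"
    by (rule finite_subset) simp
  show "symmetric (with_proj (cycle_graph n))"
    by (auto simp: symmetric_def sym_def cycle_graph_def)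
next
  have *: "Suc i mod n \<noteq> i" if "i < n" for i
    using assms that by (cases "Suc i = n") auto
  fix e assume "e \<in> parcs (cycle_graph n)"
  then show "fst e \<noteq> snd e"
    using *[of "fst e"] by (auto simp: cycle_graph_def)
qed (auto simp: cycle_graph_def)

text \<open>The weight function is constantly one, so that \<^term>\<open>wf_digraph.\<mu> G (\<lambda>_. 1)\<close>
  is the usual graph distance, with value \<open>\<infinity>\<close> between different components.\<close>

definition (in wf_digraph) graph_dist :: "'a \<Rightarrow> 'a \<Rightarrow> ereal" where
  "graph_dist u v = \<mu> (\<lambda>_. 1) u v"

definition (in wf_digraph) shortest_path :: "'a \<Rightarrow> 'b awalk \<Rightarrow> 'a \<Rightarrow> bool" where
  "shortest_path u p v \<longleftrightarrow> apath u p v \<and> ereal (real (length p)) = graph_dist u v"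

definition (in wf_digraph) kd_clique :: "nat \<Rightarrow> nat \<Rightarrow> 'a set \<Rightarrow> bool" where
  "kd_clique k d S \<longleftrightarrow> S \<subseteq> verts G \<and>
     (\<forall>T. T \<subseteq> S \<and> finite T \<and> card T = k \<longrightarrow>
        (\<exists>u p v. shortest_path u p v \<and> length p \<le> d \<and> T \<subseteq> set (awalk_verts u p)))"

definition (in wf_digraph) kd_clique_number :: "nat \<Rightarrow> nat \<Rightarrow> enat" where
  "kd_clique_number k d =
     (SUP S \<in> {S. kd_clique k d S}. if finite S then enat (card S) else \<infinity>)"

abbreviation omega_cycle :: "nat \<Rightarrow> nat \<Rightarrow> nat \<Rightarrow> enat" where
  "omega_cycle k d n \<equiv> wf_digraph.kd_clique_number (with_proj (cycle_graph n)) k d"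

end

theory Submission
  imports Defs
begin

text \<open>Put m = min(d, floor(n/2)). The vertex sets of shortest paths of length at most d are the
  arcs with at most m + 1 vertices, so a k,d-clique with at least k elements forces
  k \<open>\<le>\<close> m + 1 and, since any triple in it extends to a k-subset, is also a 3,d-clique. Three
  points lie on such an arc iff one of the three gaps between them has length at least n - m, and
  except for m = 2, n = 4 no set of m + 2 points has this property for all its triples. Hence the
  clique number is max(min(n, k - 1), m + 1), which unifies all the cases.\<close>

section \<open>Distance on the cycle\<close>

definition cdist :: "nat \<Rightarrow> nat \<Rightarrow> nat \<Rightarrow> nat" where
  "cdist n u v = (if u \<le> v then min (v - u) (n - (v - u)) else min (u - v) (n - (u - v)))"

lemma cdist_self [simp]: "cdist n u u = 0"
  by (simp add: cdist_def)

lemma cdist_le_half: "cdist n u v \<le> n div 2"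
  unfolding cdist_def min_def by auto

text \<open>Going \<open>cdist n u v\<close> steps from \<open>u\<close> in one of the two
  directions, possibly across 0, leads to \<open>v\<close>. The four linear equations replace
  \<open>min\<close> and truncated subtraction in later case splits.\<close>

lemma cdist_representation:
  assumes "u < n" "v < n"
  shows "cdist n u v + u = v \<or> cdist n u v + v = u \<or> cdist n u v + u = n + v \<or>
    cdist n u v + v = n + u"
  using assms unfolding cdist_def min_def by auto

lemma cdist_eqI:
  assumes "u < n" "v < n" "2 * c \<le> n"
    and "c + u = v \<or> c + v = u \<or> c + u = n + v \<or> c + v = n + u"
  shows "cdist n u v = c"
  using assms(4)
proof (elim disjE)
qed (use assms(1-3) in \<open>auto simp: cdist_def min_def\<close>)

lemma cdist_triangle:
  assumes "u < n" "v < n" "w < n"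
  shows "cdist n u w \<le> cdist n u v + cdist n v w"
proof -
  have D: "2 * cdist n u v \<le> n" "2 * cdist n v w \<le> n"
    using cdist_le_half[of n u v] cdist_le_half[of n v w] by linarith+
  \<comment> \<open>The distance is at most the length of either arc between \<open>u\<close> and
    \<open>w\<close>.\<close>
  have "cdist n u w + u \<le> w \<and> cdist n u w + w \<le> n + u \<or>
    cdist n u w + w \<le> u \<and> cdist n u w + u \<le> n + w"
    using assms cdist_representation[of u n w] unfolding cdist_def min_def by auto
  then show ?thesis
    using cdist_representation[OF assms(1,2)] cdist_representation[OF assms(2,3)] D assms
    by (elim disjE conjE; linarith)
qed

lemma cdist_eq_0_iff:
  assumes "u < n" "v < n"
  shows "cdist n u v = 0 \<longleftrightarrow> u = v"
  using assms unfolding cdist_def min_def by auto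

lemma cdist_commute: "cdist n u v = cdist n v u"
  unfolding cdist_def by auto

lemma cdist_step:
  assumes "u < n" "v < n" "cdist n u v > 0" "n \<ge> 3"
  shows "\<exists>w<n. cdist n u w = 1 \<and> Suc (cdist n w v) = cdist n u v"
proof -
  let ?d = "cdist n u v"
  have half: "2 * ?d \<le> n" using cdist_le_half[of n u v] by linarith
  have *: ?thesis
    if "w < n" "u + 1 = w \<or> w + 1 = u \<or> u + 1 = n + w \<or> w + 1 = n + u"
      "?d - 1 + w = v \<or> ?d - 1 + v = w \<or> ?d - 1 + w = n + v \<or> ?d - 1 + v = n + w" for w
  proof -
    have "cdist n u w = 1" by (rule cdist_eqI) (use that assms in auto)
    moreover have "cdist n w v = ?d - 1" by (rule cdist_eqI) (use that assms half in auto)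
    ultimately show ?thesis using that(1) assms(3) by auto
  qed
  \<comment> \<open>\<open>w\<close> is the neighbour of \<open>u\<close> on a shorter arc to
    \<open>v\<close>: forward in cases 1 and 3, backward in cases 2 and 4. In the last two the step
    itself may cross between \<open>n - 1\<close> and 0.\<close>
  consider "?d + u = v" | "?d + v = u" | "?d + u = n + v" | "?d + v = n + u"
    using cdist_representation[OF assms(1,2)] by blast
  then show ?thesis
  proof cases
    case 1 then show ?thesis using assms by (intro *[of "u + 1"]) auto
  next
    case 2 then show ?thesis using assms by (intro *[of "u - 1"]) auto
  next
    case 3
    show ?thesis
    proof (cases "u + 1 = n")
      case True
      then show ?thesis using 3 assms by (intro *[of 0]) auto
    next
      case False
      then show ?thesis using 3 assms by (intro *[of "u + 1"]) auto
    qed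
  next
    case 4
    show ?thesis
    proof (cases "u = 0")
      case True
      then show ?thesis using 4 assms by (intro *[of "n - 1"]) auto
    next
      case False
      then show ?thesis using 4 assms by (intro *[of "u - 1"]) auto
    qed
  qed
qed

lemma pverts_cycle_graph [simp]: "pverts (cycle_graph n) = {..<n}"
  by (simp add: cycle_graph_def)

lemma parcs_cycle_graph:
  assumes "n \<ge> 3"
  shows "(i, j) \<in> parcs (cycle_graph n) \<longleftrightarrow> i < n \<and> j < n \<and> cdist n i j = 1"
proof -
  have step: "j = Suc i mod n \<longleftrightarrow> Suc i = j \<or> Suc i = n + j" if "i < n" "j < n" for i j
    using that by (cases "Suc i = n") auto
  show ?thesis
  proof (cases "i < n \<and> j < n")
    case True
    moreover have "2 * 1 \<le> n" using assms by simp
    ultimately have "cdist n i j = 1 \<longleftrightarrow> 1 + i = j \<or> 1 + j = i \<or> 1 + i = n + j \<or> 1 + j = n + i"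
      using cdist_representation[of i n j] cdist_eqI[of i n j 1] by metis
    then show ?thesis
      using True step[of i j] step[of j i] by (simp add: cycle_graph_def) blast
  qed (auto simp: cycle_graph_def)
qed

section \<open>Gaps between points of a clique\<close>

text \<open>Three points of the circle that lie on a common geodesic cut it into three gaps, one of
  which is at least half the circle; the other two gaps form the arc carrying the points.\<close>

lemma gap_of_collinear:
  assumes "x < y" "y < z" "z < n"
    and "cdist n x y \<le> m" "cdist n y z \<le> m" "cdist n x z \<le> m"
    and "cdist n x z = cdist n x y + cdist n y z \<or> cdist n x y = cdist n x z + cdist n y z \<or>
      cdist n y z = cdist n x y + cdist n x z"
  shows "n \<le> m + (y - x) \<or> n \<le> m + (z - y) \<or> z - x \<le> m"
proof -
  have less: "cdist n u v + u = v \<and> 2 * cdist n u v \<le> n \<or> cdist n u v + v = n + u \<and> 2 * cdist n u v \<le> n"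
    if "u < v" "v < n" for u v
    using that unfolding cdist_def min_def by auto
  show ?thesis
  proof (rule ccontr)
    assume "\<not> ?thesis"
    \<comment> \<open>All three gaps are shorter than \<open>n - m\<close>, so their complements
      exceed \<open>m\<close> and the distances are the gaps themselves, with sum \<open>n\<close>.
      Collinearity makes the largest equal to half of \<open>n\<close>; its complement is then
      equally long, hence at most \<open>m\<close>, a contradiction.\<close>
    then have "m + y < n + x" "m + z < n + y" "m + x < z"
      using assms(1,2) by linarith+
    then show False
      using less[of x y] less[of y z] less[of x z] assms
      by (elim disjE conjE; simp)
  qed
qed

text \<open>The excluded case is a genuine exception: for \<open>m = 2\<close> and
  \<open>n = 4\<close> all four points satisfy the gap condition.\<close>

lemma card_le_of_gaps:
  fixes S :: "nat set"
  assumes S: "S \<subseteq> {..<n}" and m: "2 \<le> m" "2 * m \<le> n" "\<not> (m = 2 \<and> n = 4)"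
    and gap: "\<And>x y z. x \<in> S \<Longrightarrow> y \<in> S \<Longrightarrow> z \<in> S \<Longrightarrow> x < y \<Longrightarrow> y < z \<Longrightarrow>
      n \<le> m + (y - x) \<or> n \<le> m + (z - y) \<or> z - x \<le> m"
  shows "card S \<le> m + 1"
proof (rule ccontr)
  assume "\<not> card S \<le> m + 1"
  then have big: "m + 2 \<le> card S" by simp
  have fin: "finite S" using S finite_subset by blast
  have subD: "m + 2 \<le> card X" if "S \<subseteq> X" "finite X" for X
    using big card_mono[OF that(2,1)] by simp
  txt \<open>If 2m < n, a triple without a large gap consists of the least element a, the last
    element b within distance n - m - 1 after a, and the successor of b (if b is the greatest element, any
    element strictly between a and b). If n = 2m,
    by pigeonhole S contains two antipodal pairs, and a fifth element together with two points of
    these pairs has no gap of length m or more.\<close>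
  show False
  proof (cases "n = 2 * m")
    case False
    then have mn: "2 * m < n" using m by simp
    have ne: "S \<noteq> {}" using big by auto
    define a where "a = Min S"
    have a: "a \<in> S" "\<And>x. x \<in> S \<Longrightarrow> a \<le> x"
      using fin ne by (auto simp: a_def)
    define B where "B = {x \<in> S. x < a + n - m}"
    define b where "b = Max B"
    have B: "finite B" "a \<in> B" using fin a mn by (auto simp: B_def)
    have b: "b \<in> S" "b < a + n - m" and bmax: "\<And>x. x \<in> S \<Longrightarrow> b < x \<Longrightarrow> a + n - m \<le> x"
    proof -
      have "b \<in> B" unfolding b_def by (rule Max_in) (use B in auto)
      then show "b \<in> S" "b < a + n - m" by (auto simp: B_def)
      fix x assume "x \<in> S" "b < x"
      then have "x \<notin> B" using Max_ge[OF B(1), of x] by (auto simp: b_def)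
      then show "a + n - m \<le> x" using \<open>x \<in> S\<close> by (simp add: B_def)
    qed
    have ab: "a < b"
    proof (rule ccontr)
      assume "\<not> a < b"
      \<comment> \<open>This interval has at most \<open>m\<close> elements, so together with
        \<open>a\<close> it is too small to cover \<open>S\<close>.\<close>
      have "S \<subseteq> insert a {a + n - m..<n}"
      proof
        fix x assume "x \<in> S"
        then show "x \<in> insert a {a + n - m..<n}"
          using S a(2)[of x] bmax[of x] \<open>\<not> a < b\<close> by (cases "x = a") auto
      qed
      from subD[OF this] have "m + 2 \<le> card (insert a {a + n - m..<n})" by simp
      also have "\<dots> \<le> Suc (card {a + n - m..<n})" by (rule card_insert_le_m1) auto
      finally show False using mn by simp
    qed
    show False
    proof (cases "\<exists>x\<in>S. b < x")
      case False
      then have "S \<subseteq> {a..b}" using a by force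
      \<comment> \<open>The gap from \<open>b\<close> round to \<open>a\<close> is thus too short;
        the two gaps inside \<open>{a..b}\<close> are too short by the choice of
        \<open>b\<close>.\<close>
      then have len: "m + 1 \<le> b - a" using subD[of "{a..b}"] by simp
      have "\<not> S \<subseteq> {a, b}" using subD[of "{a, b}"] m ab by auto
      then obtain x where "x \<in> S" "x \<noteq> a" "x \<noteq> b" by auto
      moreover from this have "a < x" "x < b" using a False by (auto simp: order_less_le not_less)
      ultimately show False using gap[of a x b] a b len mn by auto
    next
      case True
      define C where "C = {x \<in> S. b < x}"
      define c where "c = Min C"
      have C: "finite C" "C \<noteq> {}" using fin True by (auto simp: C_def)
      have "c \<in> C" unfolding c_def using C by (rule Min_in)
      then have c: "c \<in> S" "b < c" by (auto simp: C_def)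
      have cmin: "c \<le> x" if "x \<in> S" "b < x" for x
        using that C by (auto simp: c_def C_def)
      have "S \<subseteq> {a..b} \<union> {c..<n}"
      proof
        fix x assume "x \<in> S"
        then show "x \<in> {a..b} \<union> {c..<n}" using S a cmin[of x] by (cases "b < x") auto
      qed
      then have "m + 2 \<le> card ({a..b} \<union> {c..<n})" using subD by simp
      also have "\<dots> \<le> Suc b - a + (n - c)" using card_Un_le[of "{a..b}" "{c..<n}"] by simp
      \<comment> \<open>Since \<open>S\<close> has no point strictly between \<open>b\<close> and
        \<open>c\<close>, counting bounds the gap \<open>c - b\<close> below \<open>n - m\<close>.
        The choice of \<open>b\<close> bounds \<open>b - a\<close>, and \<open>c - a\<close> is at
        least \<open>n - m\<close>, which exceeds \<open>m\<close>.\<close>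
      finally have "m + 2 \<le> Suc b - a + (n - c)" .
      then show False
        using gap[of a b c] a b c ab bmax[OF c] mn S by auto
    qed
  next
    case True
    then have m3: "3 \<le> m" using m by auto
    define A where "A = {x \<in> S. x < m}"
    \<comment> \<open>The upper half of \<open>S\<close>, shifted down by \<open>m\<close>. Elements
      of \<open>A \<inter> B\<close> are the lower ends of antipodal pairs in
      \<open>S\<close>.\<close>
    define B where "B = {x. x < m \<and> x + m \<in> S}"
    have fAB: "finite A" "finite B" by (auto simp: A_def B_def)
    have "S \<subseteq> A \<union> (\<lambda>x. x + m) ` B"
    proof
      fix x assume x: "x \<in> S"
      show "x \<in> A \<union> (\<lambda>x. x + m) ` B"
      proof (cases "x < m")
        case False
        then have "x - m \<in> B" "x = x - m + m" using x S True by (auto simp: B_def)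
        then show ?thesis by blast
      qed (use x in \<open>simp add: A_def\<close>)
    qed
    then have "m + 2 \<le> card (A \<union> (\<lambda>x. x + m) ` B)" using subD fAB by simp
    also have "\<dots> \<le> card A + card B"
      using card_Un_le[of A "(\<lambda>x. x + m) ` B"] card_image_le[OF fAB(2), of "\<lambda>x. x + m"] by simp
    also have "\<dots> = card (A \<union> B) + card (A \<inter> B)" by (rule card_Un_Int) (use fAB in auto)
    also have "card (A \<union> B) \<le> card {..<m}" by (rule card_mono) (auto simp: A_def B_def)
    finally have "2 \<le> card (A \<inter> B)" by simp
    then obtain u v where uv: "u \<in> A \<inter> B" "v \<in> A \<inter> B" "u \<noteq> v"
      by (meson card_2_iff' obtain_subset_with_card_n subsetD)
    obtain a b where ab: "a < b" "a \<in> A \<inter> B" "b \<in> A \<inter> B"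
      using uv by (metis linorder_neqE_nat)
    then have P: "a \<in> S" "b \<in> S" "a + m \<in> S" "b + m \<in> S" "b < m" by (auto simp: A_def B_def)
    have "\<not> S \<subseteq> {a, b, a + m, b + m}"
    proof
      assume "S \<subseteq> {a, b, a + m, b + m}"
      then have "m + 2 \<le> card {a, b, a + m, b + m}" using subD by simp
      also have "\<dots> \<le> 4" by (simp add: card_insert_if)
      finally show False using m3 by simp
    qed
    then obtain x where x: "x \<in> S" "x \<noteq> a" "x \<noteq> b" "x \<noteq> a + m" "x \<noteq> b + m" by auto
    then have "x < 2 * m" using S True by auto
    \<comment> \<open>The pairs cut the circle into four arcs, the one through 0 giving the first
      and last case. Joining \<open>x\<close> with the ends of the arc opposite to its own leaves
      every gap shorter than \<open>m\<close>.\<close>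
    consider "x < a" | "a < x" "x < b" | "b < x" "x < a + m"
      | "a + m < x" "x < b + m" | "b + m < x" using x by linarith
    then show False
    proof cases
      case 1 then show ?thesis using gap[of x b "a + m"] P x ab True by auto
    next
      case 2 then show ?thesis using gap[of x "a + m" "b + m"] P x ab True by auto
    next
      case 3 then show ?thesis using gap[of a x "b + m"] P x ab True by auto
    next
      case 4 then show ?thesis using gap[of a b x] P x ab True by auto
    next
      case 5 then show ?thesis using gap[of b "a + m" x] P x ab True \<open>x < 2 * m\<close> by auto
    qed
  qed
qed

section \<open>Walks and shortest paths in the cycle graph\<close>

context
  fixes n :: nat
  assumes n3: "n \<ge> 3"
begin

interpretation W: wf_digraph "with_proj (cycle_graph n)"
proof -
  interpret pair_graph "cycle_graph n" by (rule pair_graph_cycle_graph) (rule n3)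
  show "wf_digraph (with_proj (cycle_graph n))" by (rule wf_digraph_axioms)
qed

lemma awalk_cycle_verts:
  assumes "W.awalk u p v"
  shows "set (W.awalk_verts u p) \<subseteq> {..<n}"
  using assms unfolding W.awalk_conv with_proj_simps pverts_cycle_graph by blast

lemma cdist_awalk_nth_Suc:
  assumes "W.awalk u p v" "i < length p"
  shows "cdist n (W.awalk_verts u p ! i) (W.awalk_verts u p ! Suc i) = 1"
  using assms
proof (induction p arbitrary: u i)
  case (Cons e p)
  obtain x y where e: "e = (x, y)" by force
  have *: "(x, y) \<in> parcs (cycle_graph n)" "W.awalk y p v"
    using Cons.prems by (auto simp: W.awalk_Cons_iff e)
  show ?case
  proof (cases i)
    case 0
    have "W.awalk_verts y p ! 0 = y"
      using W.awalkE[OF *(2)] by (metis W.awalk_verts_non_Nil hd_conv_nth)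
    then show ?thesis using *(1) parcs_cycle_graph[OF n3] by (simp add: 0 e)
  next
    case (Suc j)
    then show ?thesis using Cons.IH[OF *(2), of j] Cons.prems by (simp add: e)
  qed
qed simp

lemma cdist_awalk_nth_le:
  assumes "W.awalk u p v" "i \<le> j" "j \<le> length p"
  shows "cdist n (W.awalk_verts u p ! i) (W.awalk_verts u p ! j) \<le> j - i"
  using assms(2,3)
proof (induction j rule: dec_induct)
  case (step j)
  have lt: "W.awalk_verts u p ! k < n" if "k \<le> length p" for k
    using awalk_cycle_verts[OF assms(1)] that
    by (metis W.length_awalk_verts le_imp_less_Suc lessThan_iff nth_mem subsetD)
  show ?case
    using step cdist_triangle[OF lt[of i] lt[of j] lt[of "Suc j"]]
      cdist_awalk_nth_Suc[OF assms(1), of j] by simp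
qed simp

lemma awalk_verts_nth_ends:
  assumes "W.awalk u p v"
  shows "W.awalk_verts u p ! 0 = u" "W.awalk_verts u p ! length p = v"
  using W.awalkE[OF assms] W.awalk_verts_non_Nil[of u p] W.length_awalk_verts[of u p]
  by (metis hd_conv_nth, metis last_conv_nth diff_Suc_1)

lemma cdist_le_awalk_length:
  assumes "W.awalk u p v"
  shows "cdist n u v \<le> length p"
  using cdist_awalk_nth_le[OF assms, of 0 "length p"] awalk_verts_nth_ends[OF assms] by simp

text \<open>The triangle inequality through positions 0, \<open>i\<close>, \<open>j\<close> and
  \<open>length p\<close> forces equality in the bounds for all three pieces.\<close>

lemma cdist_geodesic_nth:
  assumes "W.awalk u p v" "length p = cdist n u v" "i \<le> j" "j \<le> length p"
  shows "cdist n (W.awalk_verts u p ! i) (W.awalk_verts u p ! j) = j - i"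
proof -
  let ?f = "\<lambda>i. W.awalk_verts u p ! i"
  have lt: "?f k < n" if "k \<le> length p" for k
    using awalk_cycle_verts[OF assms(1)] that
    by (metis W.length_awalk_verts le_imp_less_Suc lessThan_iff nth_mem subsetD)
  have "length p \<le> cdist n (?f 0) (?f i) + cdist n (?f i) (?f j) + cdist n (?f j) (?f (length p))"
    using cdist_triangle[OF lt[of 0] lt[of i] lt[of "length p"]]
      cdist_triangle[OF lt[of i] lt[of j] lt[of "length p"]] assms(2-4)
    unfolding awalk_verts_nth_ends[OF assms(1)] by linarith
  moreover have "cdist n (?f 0) (?f i) \<le> i" "cdist n (?f i) (?f j) \<le> j - i"
    "cdist n (?f j) (?f (length p)) \<le> length p - j"
    using cdist_awalk_nth_le[OF assms(1), of 0 i] cdist_awalk_nth_le[OF assms(1), of i j]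
      cdist_awalk_nth_le[OF assms(1), of j "length p"] assms(3,4) by simp_all
  ultimately show ?thesis using assms(3,4) by linarith
qed

lemma ex_awalk_cdist:
  assumes "u < n" "v < n"
  shows "\<exists>p. W.awalk u p v \<and> length p = cdist n u v"
  using assms
proof (induction "cdist n u v" arbitrary: u)
  case 0
  then have "u = v" using cdist_eq_0_iff by metis
  then have "W.awalk u [] v \<and> length [] = cdist n u v"
    using 0 by (simp add: W.awalk_Nil_iff)
  then show ?case by blast
next
  case (Suc k)
  then obtain w where w: "w < n" "cdist n u w = 1" "Suc (cdist n w v) = cdist n u v"
    using cdist_step[OF Suc.prems _ n3] by auto
  then obtain p where p: "W.awalk w p v" "length p = cdist n w v"
    using Suc by (metis Suc_inject)
  have "W.awalk u ((u, w) # p) v \<and> length ((u, w) # p) = cdist n u v"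
    using p w Suc.prems parcs_cycle_graph[OF n3] by (simp add: W.awalk_Cons_iff)
  then show ?case by blast
qed

lemma graph_dist_cycle:
  assumes "u < n" "v < n"
  shows "W.graph_dist u v = ereal (real (cdist n u v))"
proof -
  have cost: "W.awalk_cost (\<lambda>_. 1) p = real (length p)" for p
    by (induction p) auto
  show ?thesis
    unfolding W.graph_dist_def W.\<mu>_def cost
  proof (rule antisym)
    obtain p where "W.awalk u p v" "length p = cdist n u v" using ex_awalk_cdist[OF assms] by blast
    then show "(INF p\<in>{p. W.awalk u p v}. ereal (real (length p))) \<le> ereal (real (cdist n u v))"
      by (intro INF_lower2[of p]) auto
    show "ereal (real (cdist n u v)) \<le> (INF p\<in>{p. W.awalk u p v}. ereal (real (length p)))"
      by (rule INF_greatest) (auto dest: cdist_le_awalk_length)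
  qed
qed

text \<open>Distinctness of the vertices comes for free: on a walk of minimal length, positions
  \<open>i < j\<close> are at distance \<open>j - i > 0\<close>.\<close>

lemma shortest_path_cycle_iff:
  "W.shortest_path u p v \<longleftrightarrow> W.awalk u p v \<and> length p = cdist n u v"
proof (cases "W.awalk u p v")
  case True
  have "u < n" "v < n"
    using W.awalk_hd_in_verts[OF True] W.awalk_last_in_verts[OF True]
    by auto
  moreover have "distinct (W.awalk_verts u p)" if len: "length p = cdist n u v"
  proof -
    have "W.awalk_verts u p ! i \<noteq> W.awalk_verts u p ! j" if "i < j" "j \<le> length p" for i j
      using cdist_geodesic_nth[OF True len, of i j] that by auto
    then show ?thesis
      unfolding distinct_conv_nth W.length_awalk_verts
      by (metis less_Suc_eq_le linorder_neqE_nat)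
  qed
  ultimately show ?thesis
    using True by (auto simp: W.shortest_path_def W.apath_def graph_dist_cycle)
qed (simp add: W.shortest_path_def W.apath_def)

text \<open>Distances along a geodesic are differences of positions, so the points behave like
  points on a line.\<close>

lemma collinear_shortest_path:
  assumes sp: "W.shortest_path u p v"
    and x: "x \<in> set (W.awalk_verts u p)" and y: "y \<in> set (W.awalk_verts u p)"
    and z: "z \<in> set (W.awalk_verts u p)"
  shows "cdist n x y \<le> length p"
    and "cdist n x z = cdist n x y + cdist n y z \<or> cdist n x y = cdist n x z + cdist n y z \<or>
      cdist n y z = cdist n x y + cdist n x z"
proof -
  have w: "W.awalk u p v" "length p = cdist n u v" using sp by (auto simp: shortest_path_cycle_iff)
  have idx: "\<exists>i\<le>length p. x = W.awalk_verts u p ! i" if "x \<in> set (W.awalk_verts u p)" for x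
    using that unfolding in_set_conv_nth W.length_awalk_verts by (metis less_Suc_eq_le)
  obtain i j l where i: "i \<le> length p" "x = W.awalk_verts u p ! i"
    and j: "j \<le> length p" "y = W.awalk_verts u p ! j"
    and l: "l \<le> length p" "z = W.awalk_verts u p ! l"
    using idx[OF x] idx[OF y] idx[OF z] by blast
  have D: "cdist n (W.awalk_verts u p ! i) (W.awalk_verts u p ! j) = (if i \<le> j then j - i else i - j)"
    if "i \<le> length p" "j \<le> length p" for i j
    using cdist_geodesic_nth[OF w, of i j] cdist_geodesic_nth[OF w, of j i] that
    by (simp add: cdist_commute)
  show "cdist n x y \<le> length p" using i j by (simp add: D) linarith
  show "cdist n x z = cdist n x y + cdist n y z \<or> cdist n x y = cdist n x z + cdist n y z \<or>
      cdist n y z = cdist n x y + cdist n x z"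
    using i j l by (simp add: D)
qed

section \<open>Upper bound on clique sizes\<close>

lemma finite_kd_clique_cycle:
  assumes "W.kd_clique k d S"
  shows "S \<subseteq> {..<n}" "finite S"
proof -
  show "S \<subseteq> {..<n}" using assms by (auto simp: W.kd_clique_def)
  then show "finite S" using finite_subset by blast
qed

lemma card_kd_clique_cycle_le:
  assumes S: "W.kd_clique k d S" and k: "3 \<le> k" and ex: "\<not> (k = 3 \<and> n = 4)"
  shows "card S \<le> max (min n (k - 1)) (min d (n div 2) + 1)"
proof (cases "k \<le> card S")
  case False
  have "card S \<le> n"
    using card_mono[OF _ finite_kd_clique_cycle(1)[OF S]] by simp
  then show ?thesis using False by auto
next
  case True
  define m where "m = min d (n div 2)"
  note fin = finite_kd_clique_cycle[OF S]
  have path: "\<exists>u p v. W.shortest_path u p v \<and> length p \<le> m \<and> T \<subseteq> set (W.awalk_verts u p)"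
    if T: "T \<subseteq> S" "card T = k" for T
  proof -
    have "finite T" using T(1) fin(2) finite_subset by blast
    then obtain u p v
      where p: "W.shortest_path u p v" "length p \<le> d" "T \<subseteq> set (W.awalk_verts u p)"
      using S T unfolding W.kd_clique_def by blast
    then have "length p \<le> m"
      using cdist_le_half[of n u v] by (simp add: m_def shortest_path_cycle_iff)
    then show ?thesis using p by blast
  qed
  obtain T where T: "T \<subseteq> S" "card T = k" using True obtain_subset_with_card_n by metis
  obtain u p v where p: "length p \<le> m" "T \<subseteq> set (W.awalk_verts u p)"
    using path[OF T] by blast
  have "k \<le> card (set (W.awalk_verts u p))"
    using card_mono[OF _ p(2)] T by simp
  also have "\<dots> \<le> Suc (length p)" by (metis card_length W.length_awalk_verts)
  finally have km: "k \<le> m + 1" using p by simp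
  have "card S \<le> m + 1"
  proof (rule card_le_of_gaps[OF fin(1)])
    \<comment> \<open>From \<open>3 \<le> k \<le> m + 1\<close>, the value \<open>m = 2\<close>
      forces \<open>k = 3\<close>, so the exception is the one excluded by
      \<open>ex\<close>.\<close>
    show "2 \<le> m" "2 * m \<le> n" "\<not> (m = 2 \<and> n = 4)" using km k ex by (auto simp: m_def)
    fix x y z assume xyz: "x \<in> S" "y \<in> S" "z \<in> S" "x < y" "y < z"
    \<comment> \<open>The clique property speaks of sets of size \<open>k\<close> only, so the
      triple is enlarged inside \<open>S\<close>.\<close>
    have "\<exists>T. {x, y, z} \<subseteq> T \<and> T \<subseteq> S \<and> card T = k"
      using xyz fin(2) k True by (intro exists_subset_between) auto
    then obtain T where T: "{x, y, z} \<subseteq> T" "T \<subseteq> S" "card T = k" by blast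
    obtain u p v where sp: "W.shortest_path u p v" "length p \<le> m" "T \<subseteq> set (W.awalk_verts u p)"
      using path[OF T(2,3)] by blast
    have on: "x \<in> set (W.awalk_verts u p)" "y \<in> set (W.awalk_verts u p)"
      "z \<in> set (W.awalk_verts u p)"
      using T sp by auto
    show "n \<le> m + (y - x) \<or> n \<le> m + (z - y) \<or> z - x \<le> m"
    proof (rule gap_of_collinear[OF xyz(4,5)])
      show "z < n" using xyz fin by auto
      show "cdist n x y \<le> m" "cdist n y z \<le> m" "cdist n x z \<le> m"
        using collinear_shortest_path(1)[OF sp(1)] on sp(2) by (meson le_trans)+
    qed (rule collinear_shortest_path(2)[OF sp(1) on])
  qed
  then show ?thesis by (simp add: m_def)
qed

section \<open>Cliques attaining the bound\<close>

lemma kd_clique_cycle_small: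
  assumes "S \<subseteq> {..<n}" "card S < k"
  shows "W.kd_clique k d S"
proof -
  have "finite S" using assms finite_subset by blast
  then have "card T < k" if "T \<subseteq> S" for T using that assms card_mono[of S T] by simp
  then show ?thesis using assms by (auto simp: W.kd_clique_def)
qed

text \<open>The single path from 0 to \<open>m\<close> covers every subset at once; it is geodesic
  because \<open>m\<close> is at most half of \<open>n\<close>.\<close>

lemma kd_clique_cycle_initial:
  assumes "m \<le> d" "m \<le> n div 2"
  shows "W.kd_clique k d {..m}"
proof -
  define p where "p = map (\<lambda>i. (i, Suc i)) [0..<m]"
  have cas: "W.cas 0 (map (\<lambda>i. (i, Suc i)) [0..<j]) j" for j
    by (induction j) (auto simp: W.awalk_verts_conv last_map)
  have verts: "W.awalk_verts 0 p = [0..<Suc m]"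
    by (cases m) (auto simp: W.awalk_verts_conv p_def o_def last_map)
  have "set p \<subseteq> parcs (cycle_graph n)"
    using assms n3 parcs_cycle_graph[OF n3] by (auto simp: p_def cdist_def)
  then have "W.awalk 0 p m"
    using cas[of m] n3 by (simp add: W.awalk_def p_def)
  then have "W.shortest_path 0 p m"
    using assms by (simp add: shortest_path_cycle_iff p_def cdist_def)
  moreover have "length p \<le> d" "{..m} \<subseteq> set (W.awalk_verts 0 p)"
    using assms by (auto simp: verts, simp add: p_def)
  ultimately show ?thesis
    using assms n3 unfolding W.kd_clique_def by fastforce
qed

section \<open>Values of the clique number\<close>

lemma kd_clique_number_cycle_eqI:
  assumes "\<And>S. W.kd_clique k d S \<Longrightarrow> card S \<le> N" and "W.kd_clique k d S" "card S = N"
  shows "W.kd_clique_number k d = enat N"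
  unfolding W.kd_clique_number_def
proof (rule antisym)
  show "(SUP S \<in> {S. W.kd_clique k d S}. if finite S then enat (card S) else \<infinity>) \<le> enat N"
    by (rule SUP_least) (auto simp: assms finite_kd_clique_cycle)
  show "enat N \<le> (SUP S \<in> {S. W.kd_clique k d S}. if finite S then enat (card S) else \<infinity>)"
    using assms finite_kd_clique_cycle(2)[of k d S] by (intro SUP_upper2[of S]) auto
qed

lemma omega_cycle_eq:
  assumes k: "3 \<le> k" and ex: "\<not> (k = 3 \<and> n = 4)"
  shows "omega_cycle k d n = enat (max (min n (k - 1)) (min d (n div 2) + 1))"
proof -
  let ?a = "min n (k - 1)" and ?m = "min d (n div 2)"
  have "\<exists>S. W.kd_clique k d S \<and> card S = max ?a (?m + 1)"
  \<comment> \<open>The larger term decides: fewer than \<open>k\<close> vertices form a clique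
    vacuously, otherwise an initial path does.\<close>
  proof (cases "?m + 1 \<le> ?a")
    case True
    then show ?thesis
      using k by (intro exI[of _ "{..<?a}"] conjI kd_clique_cycle_small) auto
  next
    case False
    then show ?thesis
      by (intro exI[of _ "{..?m}"] conjI kd_clique_cycle_initial) auto
  qed
  then show ?thesis
    using kd_clique_number_cycle_eqI card_kd_clique_cycle_le[OF _ k ex] by metis
qed

text \<open>Omitting one vertex \<open>t\<close> of the 4-cycle leaves a path of length 2 between
  antipodal vertices, so the whole vertex set is a clique.\<close>

lemma omega_cycle_4:
  assumes n: "n = 4" and d: "2 \<le> d"
  shows "omega_cycle 3 d n = 4"
proof -
  have path: "W.shortest_path a [(a, b), (b, c)] c"
    if "a < n" "b < n" "c < n" "cdist n a b = 1" "cdist n b c = 1" "cdist n a c = 2" for a b c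
    using that parcs_cycle_graph[OF n3]
    by (simp add: shortest_path_cycle_iff W.awalk_simps)
  have "W.kd_clique 3 d {..<n}"
    unfolding W.kd_clique_def
  proof (intro conjI allI impI)
    show "{..<n} \<subseteq> verts (with_proj (cycle_graph n))" by simp
    fix T assume T: "T \<subseteq> {..<n} \<and> finite T \<and> card T = 3"
    then have "T \<noteq> {..<n}" using n by auto
    then obtain t where t: "t < n" "t \<notin> T" using T by auto
    define a b c where "a = (t + 1) mod 4" "b = (t + 2) mod 4" "c = (t + 3) mod 4"
    have "t \<in> {0, 1, 2, 3}" using t n by auto
    then have abc: "a < n" "b < n" "c < n" "cdist n a b = 1" "cdist n b c = 1" "cdist n a c = 2"
      "{..<n} \<subseteq> {t, a, b, c}"
      unfolding a_b_c_def n by (auto simp: cdist_def)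
    then have "T \<subseteq> set (W.awalk_verts a [(a, b), (b, c)])" using T t by auto
    then show "\<exists>u p v. W.shortest_path u p v \<and> length p \<le> d \<and> T \<subseteq> set (W.awalk_verts u p)"
      using path[OF abc(1-6)] d by (intro exI[of _ a] exI[of _ "[(a, b), (b, c)]"] exI[of _ c]) auto
  qed
  moreover have "card S \<le> n" if "W.kd_clique 3 d S" for S
    using card_mono[OF _ finite_kd_clique_cycle(1)[OF that]] by simp
  ultimately have "omega_cycle 3 d n = enat n" by (intro kd_clique_number_cycle_eqI) auto
  then show ?thesis using n by (simp add: numeral_eq_enat)
qed

end

theorem proposition5p10:
  fixes k d n :: nat
  assumes "3 \<le> k" and "k \<le> d + 1" and "n \<ge> 3"
  shows "(k = 3 \<and> n = 4 \<longrightarrow> omega_cycle k d n = 4) \<and>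
    (\<not> (k = 3 \<and> n = 4) \<longrightarrow>
      ((n \<le> k - 1 \<longrightarrow> omega_cycle k d n = enat n) \<and>
       (n \<ge> k \<and> n div 2 + 1 \<le> k - 1 \<longrightarrow> omega_cycle k d n = enat (k - 1)) \<and>
       (n div 2 + 1 > k - 1 \<longrightarrow> omega_cycle k d n = enat (min (n div 2 + 1) (d + 1)))) \<and>
      ((n \<le> k - 1 \<longrightarrow> omega_cycle k d n = enat n) \<and>
       (k \<le> n \<and> n \<le> 2 * k - 3 \<longrightarrow> omega_cycle k d n = enat (k - 1)) \<and>
       (2 * k - 2 \<le> n \<and> n \<le> 2 * d - 1 \<longrightarrow> omega_cycle k d n = enat (n div 2 + 1)) \<and>
       (n \<ge> 2 * d \<longrightarrow> omega_cycle k d n = enat (d + 1))))"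
proof (cases "k = 3 \<and> n = 4")
  case True
  then show ?thesis using omega_cycle_4[OF assms(3)] assms by simp
next
  case False
  define q where "q = n div 2"
  have q: "2 * q \<le> n" "n \<le> 2 * q + 1" by (simp_all add: q_def)
  have omega: "omega_cycle k d n = enat (max (min n (k - 1)) (min d q + 1))"
    using omega_cycle_eq[OF assms(3,1) False] by (simp add: q_def)
  have small: "max (min n (k - 1)) (min d q + 1) = n" if "n \<le> k - 1"
    using that assms q by linarith
  have medium: "max (min n (k - 1)) (min d q + 1) = k - 1" if "k \<le> n" "q + 1 \<le> k - 1"
    using that by linarith
  \<comment> \<open>Here \<open>q + 1\<close> and \<open>d + 1\<close> are both at least
    \<open>k\<close>, so the second term of the maximum wins.\<close>
  have large: "max (min n (k - 1)) (min d q + 1) = min (q + 1) (d + 1)" if "k - 1 < q + 1"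
    using that assms(2) by linarith
  \<comment> \<open>The ranges of the second formula are translated into conditions on
    \<open>q\<close>; the odd bounds \<open>2 * k - 3\<close> and \<open>2 * d - 1\<close> absorb
    the rounding.\<close>
  have "q + 1 \<le> k - 1" if "k \<le> n" "n \<le> 2 * k - 3" using that assms(1) q by linarith
  moreover have "k - 1 < q + 1" "min (q + 1) (d + 1) = q + 1" if "2 * k - 2 \<le> n" "n \<le> 2 * d - 1"
    using that assms q by linarith+
  moreover have "k - 1 < q + 1" "min (q + 1) (d + 1) = d + 1" if "2 * d \<le> n"
    using that assms q by linarith+
  ultimately show ?thesis
    using False small medium large unfolding omega q_def[symmetric] by metis
qed

end
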